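(* Let $U$ and $V$ be Banach spaces with norms $\|\cdot\|_U$ and $\|\cdot\|_V$. For every $\varepsilon>0$ let $\bar u_\varepsilon\in U$ and $F_\varepsilon\in C^1(U;V)$ be given. Let $u_0\in U$ be such that (a) there exist $\varepsilon_0>0$ and $\rho>0$ such that for all $\varepsilon\in(0,\varepsilon_0]$ the operators $F_\varepsilon'(u_0)$ are Fredholm of index zero from $U$ into $V$, and $\|F_\varepsilon'(u_0)u\|_V\ge\rho\|u\|_U$ for all $u\in U$. Let $\|\cdot\|_\infty$ be a norm in $U$ such that (b) $\sigma:=\sup\{\|u\|_\infty:\ u\in U,\ \|u\|_U\le1\}<\infty$; (c) $\displaystyle\sup_{\|v\|_U\le1}\|(F_\varepsilon'(u_0+u)-F_\varepsilon'(u_0))v\|_V\to0$ for $\varepsilon+\|u\|_\infty\to0$. Further, suppose that (d) $\|\bar u_\varepsilon-u_0\|_\infty+\|F_\varepsilon(\bar u_\varepsilon)\|_V\to0$ for $\varepsilon\to0$. Then there exist $\varepsilon_1\in(0,\varepsilon_0]$ and $\delta>0$ such that for all $\varepsilon\in(0,\varepsilon_1]$ there exists exactly one solution $u=u_\varepsilon$ to $F_\varepsilon(u)=0$ with $\|u-u_0\|_\infty\le\delta$, and $$\|u_\varepsilon-u_0\|_\infty\le\|\bar u_\varepsilon-u_0\|_\infty+\frac{4\sigma}{\rho}\|F_\varepsilon(\bar u_\varepsilon)\|_V.$$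
   Context: $F_\varepsilon'(u)$ denotes the Fréchet derivative of $F_\varepsilon$ at $u$ with respect to the norms $\|\cdot\|_U$, $\|\cdot\|_V$. The norm $\|\cdot\|_\infty$ is just a second norm on $U$; $U$ need not be complete with respect to it. The limit "for $\varepsilon+\|u\|_\infty\to0$" is taken over all $\varepsilon>0$ and $u\in U$ jointly: for each $\eta>0$ there is $\kappa>0$ such that the quantity is at most $\eta$ whenever $\varepsilon>0$, $u\in U$ and $\varepsilon+\|u\|_\infty\le\kappa$. *)

theory Defs
  imports "HOL-Analysis.Analysis"
begin

definition is_norm :: "('a::real_vector \<Rightarrow> real) \<Rightarrow> bool" where
  "is_norm N \<longleftrightarrow>
     (\<forall>x. 0 \<le> N x) \<and>
     (\<forall>x. N x = 0 \<longleftrightarrow> x = 0) \<and>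
     (\<forall>c x. N (c *\<^sub>R x) = \<bar>c\<bar> * N x) \<and>
     (\<forall>x y. N (x + y) \<le> N x + N y)"

definition finite_dimensional :: "'a::real_vector set \<Rightarrow> bool" where
  "finite_dimensional S \<longleftrightarrow> (\<exists>B. finite B \<and> S \<subseteq> span B)"

text \<open>For a subspace \<open>S\<close>, the following says that the projection onto the quotient space by
  \<open>S\<close> maps \<open>B\<close> bijectively onto a basis of that quotient.\<close>

definition quotient_basis :: "'a::real_vector set \<Rightarrow> 'a set \<Rightarrow> bool" where
  "quotient_basis S B \<longleftrightarrow> independent B \<and> span B \<inter> S = {0} \<and> span (S \<union> B) = UNIV"

definition finite_codimensional :: "'a::real_vector set \<Rightarrow> bool" where
  "finite_codimensional S \<longleftrightarrow> (\<exists>B. finite B \<and> quotient_basis S B)"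

text \<open>The codimension is only meaningful for subspaces of finite codimension; there it does
  not depend on the choice, see the lemma \<open>codim_eq_card\<close>.\<close>

definition codim :: "'a::real_vector set \<Rightarrow> nat" where
  "codim S = card (SOME B. finite B \<and> quotient_basis S B)"

lemma quotient_basis_card_le:
  fixes S :: "'a::real_vector set"
  assumes S: "subspace S" and B: "finite B" "quotient_basis S B" and C: "quotient_basis S C"
  shows "finite C \<and> card C \<le> card B"
proof -
  have ex: "\<exists>b. b \<in> span B \<and> x - b \<in> S" for x
  proof -
    have "x \<in> span (S \<union> B)"
      using B by (simp add: quotient_basis_def)
    then obtain s b where "x = s + b" "s \<in> span S" "b \<in> span B"
      unfolding span_Un by auto
    then show ?thesis
      using S by (metis add_diff_cancel_right' span_eq_iff)
  qed
  then obtain p where p: "\<And>x. p x \<in> span B" "\<And>x. x - p x \<in> S"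
    by metis
  have uniq: "b = p x" if "b \<in> span B" "x - b \<in> S" for b x
  proof -
    have "b - p x \<in> span B"
      using that p by (simp add: span_diff)
    moreover have "b - p x \<in> S"
      using subspace_diff[OF S p(2)[of x] that(2)] by simp
    ultimately have "b - p x \<in> span B \<inter> S"
      by blast
    also have "span B \<inter> S = {0}"
      using B(2) by (simp add: quotient_basis_def)
    finally have "b - p x = 0"
      by blast
    then show ?thesis
      by simp
  qed
  have "linear p"
  proof (rule linearI)
    fix x y
    show "p (x + y) = p x + p y"
      using subspace_add[OF S p(2)[of x] p(2)[of y]] p
      by (intro uniq[symmetric] span_add) (auto simp: algebra_simps)
  next
    fix c x
    show "p (c *\<^sub>R x) = c *\<^sub>R p x"
      using subspace_scale[OF S p(2)[of x], of c] p
      by (intro uniq[symmetric] span_scale) (auto simp: algebra_simps)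
  qed
  have "span C \<inter> S = {0}"
    using C by (simp add: quotient_basis_def)
  then have "x = 0" if "x \<in> span C" "p x = 0" for x
    using that p(2)[of x] by auto
  then have inj: "inj_on p (span C)"
    using \<open>linear p\<close> linear_inj_on_iff_eq_0[OF \<open>linear p\<close> subspace_span] by blast
  have "independent (p ` C)"
    using linear_independent_injective_image[OF \<open>linear p\<close> _ inj] C
    by (simp add: quotient_basis_def)
  then have "finite (p ` C) \<and> card (p ` C) \<le> card B"
    using independent_span_bound[OF B(1)] p(1) by blast
  moreover have "inj_on p C"
    using inj span_superset by (rule inj_on_subset)
  ultimately show ?thesis
    by (simp add: card_image finite_image_iff)
qed

lemma codim_eq_card:
  assumes "subspace S" "finite B" "quotient_basis S B"
  shows "codim S = card B"
proof -
  let ?C = "SOME B. finite B \<and> quotient_basis S B"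
  have "finite ?C \<and> quotient_basis S ?C"
    by (rule someI[of _ B]) (use assms in simp)
  then show ?thesis
    using quotient_basis_card_le[OF assms(1)] assms unfolding codim_def
    by (metis le_antisym)
qed

text \<open>Between Banach spaces, a bounded operator whose range has finite codimension has closed
  range, so closedness is not required separately.\<close>

definition fredholm :: "('a::banach \<Rightarrow>\<^sub>L 'b::banach) \<Rightarrow> bool" where
  "fredholm T \<longleftrightarrow>
     finite_dimensional {x. blinfun_apply T x = 0} \<and>
     finite_codimensional (range (blinfun_apply T))"

definition fredholm_index :: "('a::banach \<Rightarrow>\<^sub>L 'b::banach) \<Rightarrow> int" where
  "fredholm_index T =
     int (dim {x. blinfun_apply T x = 0}) - int (codim (range (blinfun_apply T)))"

end

theory Submission
  imports Defs
begin

text \<open>Near \<open>u0\<close> the equation \<open>F \<epsilon> u = 0\<close> is solved by the simplified Newton iteration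
  \<open>u \<mapsto> u - A\<inverse> (F \<epsilon> u)\<close> with the derivative kept fixed at \<open>A = F' \<epsilon> u0\<close>.

  The lower bound \<open>\<rho>\<close> makes \<open>A\<close> injective, and index zero then forces it to be onto
  (\<open>fredholm_index_zero_inj_imp_surj\<close>), so \<open>A\<inverse>\<close> exists and has norm at most \<open>1 / \<rho>\<close>. By
  (c), the derivative differs from \<open>A\<close> by at most \<open>\<rho> / 2\<close> in operator norm on a ball
  \<open>S\<close> of the \<^emph>\<open>second\<close> norm \<open>N\<close>, with a radius \<open>\<delta>\<close> that does not depend on \<open>\<epsilon>\<close>. This
  ball is convex, so the mean value inequality makes the iteration a contraction on \<open>S\<close> with
  constant \<open>1 / 2\<close> in the norm of the space, which gives uniqueness in \<open>S\<close>.

  For existence, \<open>S\<close> itself is a poor domain, since the iteration need not map it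
  to itself: the contraction estimate is in the norm of the space, in which \<open>S\<close> may be
  unbounded. The iteration does preserve the closed ball (for the norm of the space) around the
  approximate solution \<open>ubar \<epsilon>\<close> of radius \<open>2 / \<rho> * norm (F \<epsilon> (ubar \<epsilon>))\<close>, and Banach's
  fixed point theorem applies there (\<open>simplified_newton\<close>). Because \<open>N u \<le> \<sigma> * norm u\<close>, assumption
  (d) places that ball inside \<open>S\<close> for small \<open>\<epsilon>\<close>. The error estimate comes out with the
  constant \<open>2 * \<sigma> / \<rho>\<close>, half of the one asserted.\<close>

lemma is_norm_le_Sup:
  assumes N: "is_norm N" and bdd: "bdd_above {N u |u. norm u \<le> 1}"
  shows "N (u::'a::real_normed_vector) \<le> Sup {N u |u. norm u \<le> 1} * norm u"
proof (cases "u = 0")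
  case True
  moreover have "N 0 = 0"
    using N by (simp add: is_norm_def)
  ultimately show ?thesis
    by simp
next
  case False
  have "N ((1 / norm u) *\<^sub>R u) \<le> Sup {N u |u. norm u \<le> 1}"
    using False by (intro cSup_upper bdd) auto
  moreover have "N ((1 / norm u) *\<^sub>R u) = N u / norm u"
    using N by (simp add: is_norm_def)
  ultimately show ?thesis
    using False by (simp add: field_simps)
qed

lemma is_norm_Sup_nonneg:
  assumes N: "is_norm N" and bdd: "bdd_above {N u |u. norm u \<le> 1}"
  shows "0 \<le> Sup {N (u::'a::real_normed_vector) |u. norm u \<le> 1}"
proof -
  have "N 0 \<le> Sup {N u |u::'a. norm u \<le> 1}"
    by (rule cSup_upper[OF _ bdd]) auto
  moreover have "N 0 = 0"
    using N by (simp add: is_norm_def)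
  ultimately show ?thesis
    by simp
qed

lemma convex_is_norm_ball:
  assumes N: "is_norm N"
  shows "convex {u. N (u - a) \<le> r}"
proof (rule convexI)
  fix x y :: 'a and s t :: real
  assume x: "x \<in> {u. N (u - a) \<le> r}" and y: "y \<in> {u. N (u - a) \<le> r}"
    and st: "0 \<le> s" "0 \<le> t" "s + t = 1"
  have "a = s *\<^sub>R a + t *\<^sub>R a"
    using st(3) by (metis scaleR_add_left scaleR_one)
  then have "s *\<^sub>R x + t *\<^sub>R y - a = s *\<^sub>R (x - a) + t *\<^sub>R (y - a)"
    by (simp add: algebra_simps)
  then have "N (s *\<^sub>R x + t *\<^sub>R y - a) \<le> N (s *\<^sub>R (x - a)) + N (t *\<^sub>R (y - a))"
    using N unfolding is_norm_def by metis
  also have "\<dots> = s * N (x - a) + t * N (y - a)"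
    using N st by (simp add: is_norm_def)
  also have "\<dots> \<le> s * r + t * r"
    using x y st by (intro add_mono mult_left_mono) auto
  also have "\<dots> = r"
    using st(3) by (metis distrib_right mult_1)
  finally show "s *\<^sub>R x + t *\<^sub>R y \<in> {u. N (u - a) \<le> r}"
    by simp
qed

text \<open>A trivial kernel and index zero give codimension zero, so a basis of the quotient by the
  range is empty.\<close>

lemma fredholm_index_zero_inj_imp_surj:
  assumes fred: "fredholm T" and ind: "fredholm_index T = 0"
    and inj: "\<And>x. blinfun_apply T x = 0 \<Longrightarrow> x = 0"
  shows "surj (blinfun_apply T)"
proof -
  let ?R = "range (blinfun_apply T)"
  obtain B where B: "finite B" "quotient_basis ?R B"
    using fred by (auto simp: fredholm_def finite_codimensional_def)
  have R: "subspace ?R"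
    using blinfun.bounded_linear_right[THEN bounded_linear.linear]
    by (rule linear_subspace_image) simp
  have "{x. blinfun_apply T x = 0} = {0}"
    using inj by (auto simp: blinfun.zero_right)
  then have "codim ?R = 0"
    using ind dim_le_card[of "{0::'a}" "{}"] by (simp add: fredholm_index_def)
  then have "B = {}"
    using codim_eq_card[OF R B] B(1) by simp
  then have "span ?R = UNIV"
    using B(2) by (simp add: quotient_basis_def)
  then show ?thesis
    using R by (metis span_eq_iff)
qed

text \<open>Hypothesis (c) measures differences of derivatives by a supremum over the unit ball. A
  conditionally complete supremum is informative only if the set is bounded above, which
  continuity of the operator ensures.\<close>

lemma norm_blinfun_le_SUP_unit_ball:
  fixes T :: "'a::real_normed_vector \<Rightarrow>\<^sub>L 'b::real_normed_vector"
  shows "norm T \<le> (SUP v\<in>{v. norm v \<le> 1}. norm (blinfun_apply T v))" (is "_ \<le> ?s")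
proof -
  have bdd: "bdd_above ((\<lambda>v. norm (blinfun_apply T v)) ` {v. norm v \<le> 1})"
  proof (rule bdd_aboveI2)
    fix v :: 'a
    assume "v \<in> {v. norm v \<le> 1}"
    then have "norm T * norm v \<le> norm T * 1"
      by (intro mult_left_mono) auto
    then show "norm (blinfun_apply T v) \<le> norm T"
      using norm_blinfun[of T v] by linarith
  qed
  have le: "norm (blinfun_apply T v) \<le> ?s" if "norm v \<le> 1" for v
    using that by (intro cSUP_upper bdd) auto
  show ?thesis
  proof (rule norm_blinfun_bound)
    show "0 \<le> ?s"
      using le[of 0] by (simp add: blinfun.zero_right)
    fix v
    show "norm (blinfun_apply T v) \<le> ?s * norm v"
    proof (cases "v = 0")
      case False
      then show ?thesis
        using le[of "(1 / norm v) *\<^sub>R v"] by (simp add: blinfun.scaleR_right field_simps)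
    qed (simp add: blinfun.zero_right)
  qed
qed

text \<open>The simplified Newton map \<open>u \<mapsto> u - A\<inverse> (f u)\<close> is a contraction on \<open>S\<close>: applying
  \<open>A\<close> to a difference of its values gives a difference of values of \<open>A - f\<close>, and the
  derivative of \<open>A - f\<close> is at most half the lower bound of \<open>A\<close>. A map with contraction
  constant \<open>1 / 2\<close> that moves \<open>b\<close> by \<open>norm (f b) / \<rho>\<close> preserves the ball around
  \<open>b\<close> of twice that radius.\<close>

lemma simplified_newton:
  fixes f :: "'a::banach \<Rightarrow> 'b::real_normed_vector" and A :: "'a \<Rightarrow>\<^sub>L 'b"
  assumes \<rho>: "\<rho> > 0"
    and below: "\<And>x. \<rho> * norm x \<le> norm (blinfun_apply A x)"
    and surj: "surj (blinfun_apply A)"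
    and S: "convex S"
    and deriv: "\<And>u. u \<in> S \<Longrightarrow> (f has_derivative blinfun_apply (f' u)) (at u within S)"
    and close: "\<And>u. u \<in> S \<Longrightarrow> norm (f' u - A) \<le> \<rho> / 2"
    and ball: "cball b (2 / \<rho> * norm (f b)) \<subseteq> S"
  shows "\<exists>!u. u \<in> S \<and> f u = 0"
    and "\<And>u. u \<in> S \<Longrightarrow> f u = 0 \<Longrightarrow> norm (u - b) \<le> 2 / \<rho> * norm (f b)"
proof -
  define r where "r = 2 / \<rho> * norm (f b)"
  define G where "G u = u - inv (blinfun_apply A) (f u)" for u
  have r0: "0 \<le> r"
    using \<rho> by (simp add: r_def)
  have AG: "blinfun_apply A (G u) = blinfun_apply A u - f u" for u
    by (simp add: G_def blinfun.diff_right surj_f_inv_f[OF surj])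
  have fix_iff: "G u = u \<longleftrightarrow> f u = 0" for u
  proof
    assume "f u = 0"
    then have "\<rho> * norm (G u - u) \<le> 0"
      using below[of "G u - u"] AG[of u] by (simp add: blinfun.diff_right)
    then show "G u = u"
      using \<rho> by (simp add: mult_le_0_iff)
  qed (use AG[of u] in simp)
  have contr: "norm (G x - G y) \<le> 1 / 2 * norm (x - y)" if "x \<in> S" "y \<in> S" for x y
  proof -
    have "norm ((f x - blinfun_apply A x) - (f y - blinfun_apply A y)) \<le> \<rho> / 2 * norm (x - y)"
    proof (rule differentiable_bound[OF S _ _ that])
      fix u
      assume u: "u \<in> S"
      show "((\<lambda>u. f u - blinfun_apply A u) has_derivative blinfun_apply (f' u - A)) (at u within S)"
        unfolding blinfun.diff_left[abs_def]
        by (intro has_derivative_diff deriv[OF u] bounded_linear_imp_has_derivative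
            blinfun.bounded_linear_right)
      show "onorm (blinfun_apply (f' u - A)) \<le> \<rho> / 2"
        using close[OF u] by (simp add: norm_blinfun.rep_eq)
    qed
    moreover have "blinfun_apply A (G x - G y) =
        - ((f x - blinfun_apply A x) - (f y - blinfun_apply A y))"
      by (simp add: blinfun.diff_right AG)
    ultimately have "norm (blinfun_apply A (G x - G y)) \<le> \<rho> / 2 * norm (x - y)"
      by (metis norm_minus_cancel)
    then have "\<rho> * norm (G x - G y) \<le> \<rho> * (1 / 2 * norm (x - y))"
      using below[of "G x - G y"] by simp
    then show ?thesis
      using \<rho> by (rule mult_left_le_imp_le)
  qed
  have ball_r: "cball b r \<subseteq> S"
    using ball by (simp only: r_def)
  have bS: "b \<in> S"
    by (rule subsetD[OF ball]) (use r0 in \<open>simp add: r_def\<close>)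
  have "\<rho> * norm (G b - b) \<le> norm (f b)"
    using below[of "G b - b"] by (simp add: blinfun.diff_right AG)
  then have Gb: "norm (G b - b) \<le> r / 2"
    using \<rho> by (simp add: r_def field_simps)
  have step: "norm (G u - b) \<le> 1 / 2 * norm (u - b) + r / 2" if "u \<in> S" for u
    using contr[OF that bS] Gb norm_triangle_ineq[of "G u - G b" "G b - b"] by simp
  have "\<exists>!u. u \<in> cball b r \<and> G u = u"
  proof (rule Banach_fix[where c = "1 / 2"])
    show "complete (cball b r)"
      by (simp add: complete_eq_closed)
    show "cball b r \<noteq> {}"
      using r0 by simp
    have "dist b (G u) \<le> r" if "u \<in> cball b r" for u
      using step[OF subsetD[OF ball_r that]] that by (simp add: dist_norm norm_minus_commute)
    then show "G ` cball b r \<subseteq> cball b r"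
      by auto
    show "dist (G x) (G y) \<le> 1 / 2 * dist x y" if "x \<in> cball b r" "y \<in> cball b r" for x y
      using contr[OF that[THEN subsetD[OF ball_r]]] by (simp add: dist_norm)
  qed auto
  then obtain u where u: "u \<in> S" "f u = 0"
    using ball_r fix_iff by blast
  show "\<exists>!u. u \<in> S \<and> f u = 0"
  proof (rule ex1I[of _ u])
    fix w
    assume "w \<in> S \<and> f w = 0"
    then have "norm (w - u) \<le> 1 / 2 * norm (w - u)"
      using contr[of w u] u fix_iff by metis
    then show "w = u"
      by simp
  qed (use u in simp)
  fix w
  assume "w \<in> S" "f w = 0"
  then have "norm (w - b) \<le> r"
    using step[of w] fix_iff[of w] by simp
  then show "norm (w - b) \<le> 2 / \<rho> * norm (f b)"
    by (simp only: r_def)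
qed

theorem corollary2p3:
  fixes F :: "real \<Rightarrow> 'u::banach \<Rightarrow> 'v::banach"
    and F' :: "real \<Rightarrow> 'u \<Rightarrow> 'u \<Rightarrow>\<^sub>L 'v"
    and ubar :: "real \<Rightarrow> 'u" and u0 :: 'u
    and N :: "'u \<Rightarrow> real"
    and \<epsilon>0 \<rho> \<sigma> :: real
  assumes F_deriv:
      "\<And>\<epsilon> u. \<epsilon> > 0 \<Longrightarrow> (F \<epsilon> has_derivative blinfun_apply (F' \<epsilon> u)) (at u)"
    and F_C1: "\<And>\<epsilon>. \<epsilon> > 0 \<Longrightarrow> continuous_on UNIV (F' \<epsilon>)"
    and a_pos: "\<epsilon>0 > 0" "\<rho> > 0"
    and a_fredholm:
      "\<And>\<epsilon>. \<epsilon> \<in> {0<..\<epsilon>0} \<Longrightarrow> fredholm (F' \<epsilon> u0) \<and> fredholm_index (F' \<epsilon> u0) = 0"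
    and a_below:
      "\<And>\<epsilon> u. \<epsilon> \<in> {0<..\<epsilon>0} \<Longrightarrow> norm (blinfun_apply (F' \<epsilon> u0) u) \<ge> \<rho> * norm u"
    and N: "is_norm N"
    and b_bdd: "bdd_above {N u |u. norm u \<le> 1}"
    and b_sigma: "\<sigma> = Sup {N u |u. norm u \<le> 1}"
    and c: "\<And>\<eta>. \<eta> > 0 \<Longrightarrow> \<exists>\<kappa>>0. \<forall>\<epsilon>>0. \<forall>u. \<epsilon> + N u \<le> \<kappa> \<longrightarrow>
      (SUP v\<in>{v. norm v \<le> 1}. norm (blinfun_apply (F' \<epsilon> (u0 + u) - F' \<epsilon> u0) v)) \<le> \<eta>"
    and d: "((\<lambda>\<epsilon>. N (ubar \<epsilon> - u0) + norm (F \<epsilon> (ubar \<epsilon>))) \<longlongrightarrow> 0) (at_right 0)"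
  shows "\<exists>\<epsilon>1\<in>{0<..\<epsilon>0}. \<exists>\<delta>>0. \<forall>\<epsilon>\<in>{0<..\<epsilon>1}.
    (\<exists>!u. F \<epsilon> u = 0 \<and> N (u - u0) \<le> \<delta>) \<and>
    (\<forall>u. F \<epsilon> u = 0 \<and> N (u - u0) \<le> \<delta> \<longrightarrow>
      N (u - u0) \<le> N (ubar \<epsilon> - u0) + 4 * \<sigma> / \<rho> * norm (F \<epsilon> (ubar \<epsilon>)))"
proof -
  have \<sigma>0: "0 \<le> \<sigma>" and N_le: "\<And>u. N u \<le> \<sigma> * norm u"
    using is_norm_Sup_nonneg[OF N b_bdd] is_norm_le_Sup[OF N b_bdd] by (auto simp: b_sigma)
  have N_tri: "N (x + y) \<le> N x + N y" and N_nonneg: "0 \<le> N x" for x y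
    using N by (auto simp: is_norm_def)
  obtain \<kappa> where \<kappa>: "\<kappa> > 0" and \<kappa>_le: "\<And>\<epsilon> u. \<epsilon> > 0 \<Longrightarrow> \<epsilon> + N u \<le> \<kappa> \<Longrightarrow>
      (SUP v\<in>{v. norm v \<le> 1}. norm (blinfun_apply (F' \<epsilon> (u0 + u) - F' \<epsilon> u0) v)) \<le> \<rho> / 2"
    using c[of "\<rho> / 2"] a_pos by auto
  \<comment> \<open>In (c) the sum \<open>\<epsilon> + N u\<close> has to stay below \<open>\<kappa>\<close>; each summand gets half of it.\<close>
  define \<delta> where "\<delta> = \<kappa> / 2"
  \<comment> \<open>Bounding the quantity in (d) by \<open>\<delta> / C\<close> keeps the Newton ball within the
    \<open>N\<close>-distance \<open>\<delta>\<close> of \<open>u0\<close>.\<close>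
  define C where "C = 1 + 2 * \<sigma> / \<rho>"
  have \<delta>: "\<delta> > 0" and C: "C \<ge> 1"
    using \<kappa> \<sigma>0 a_pos by (auto simp: \<delta>_def C_def)
  have "\<forall>\<^sub>F \<epsilon> in at_right 0. N (ubar \<epsilon> - u0) + norm (F \<epsilon> (ubar \<epsilon>)) < \<delta> / C"
    using order_tendstoD(2)[OF d, of "\<delta> / C"] \<delta> C by simp
  then obtain e where e: "e > 0" and
    small: "\<And>\<epsilon>. 0 < \<epsilon> \<Longrightarrow> \<epsilon> < e \<Longrightarrow> N (ubar \<epsilon> - u0) + norm (F \<epsilon> (ubar \<epsilon>)) < \<delta> / C"
    by (auto simp: eventually_at_right_field)
  define \<epsilon>1 where "\<epsilon>1 = min \<epsilon>0 (min \<delta> (e / 2))"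
  have \<epsilon>1: "\<epsilon>1 \<in> {0<..\<epsilon>0}"
    using e \<delta> a_pos by (simp add: \<epsilon>1_def)
  have "(\<exists>!u. F \<epsilon> u = 0 \<and> N (u - u0) \<le> \<delta>) \<and>
      (\<forall>u. F \<epsilon> u = 0 \<and> N (u - u0) \<le> \<delta> \<longrightarrow>
        N (u - u0) \<le> N (ubar \<epsilon> - u0) + 4 * \<sigma> / \<rho> * norm (F \<epsilon> (ubar \<epsilon>)))"
    if "\<epsilon> \<in> {0<..\<epsilon>1}" for \<epsilon>
  proof -
    have \<epsilon>: "\<epsilon> > 0" "\<epsilon> \<in> {0<..\<epsilon>0}" "\<epsilon> \<le> \<delta>" "\<epsilon> < e"
      using that e by (auto simp: \<epsilon>1_def)
    define S where "S = {u. N (u - u0) \<le> \<delta>}"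
    let ?b = "ubar \<epsilon>"
    let ?r = "2 / \<rho> * norm (F \<epsilon> ?b)"
    have near: "N (u - u0) \<le> N (?b - u0) + 2 * \<sigma> / \<rho> * norm (F \<epsilon> ?b)"
      if "norm (u - ?b) \<le> ?r" for u
    proof -
      have "N (u - ?b) \<le> \<sigma> * ?r"
        using N_le[of "u - ?b"] mult_left_mono[OF that \<sigma>0] by linarith
      then show ?thesis
        using N_tri[of "u - ?b" "?b - u0"] by (simp add: algebra_simps)
    qed
    have "N (?b - u0) + 2 * \<sigma> / \<rho> * norm (F \<epsilon> ?b) \<le> C * (N (?b - u0) + norm (F \<epsilon> ?b))"
      using N_nonneg[of "?b - u0"] \<sigma>0 a_pos by (simp add: C_def algebra_simps)
    also have "\<dots> \<le> \<delta>"
      using small[OF \<epsilon>(1,4)] C by (simp add: field_simps)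
    finally have fits: "N (?b - u0) + 2 * \<sigma> / \<rho> * norm (F \<epsilon> ?b) \<le> \<delta>" .
    have below: "\<rho> * norm x \<le> norm (blinfun_apply (F' \<epsilon> u0) x)" for x
      using a_below[OF \<epsilon>(2)] .
    have inj: "x = 0" if "blinfun_apply (F' \<epsilon> u0) x = 0" for x
      using below[of x] that a_pos by (simp add: mult_le_0_iff)
    have surj: "surj (blinfun_apply (F' \<epsilon> u0))"
      using a_fredholm[OF \<epsilon>(2)] by (intro fredholm_index_zero_inj_imp_surj inj) auto
    have S: "convex S"
      unfolding S_def by (rule convex_is_norm_ball[OF N])
    have deriv: "(F \<epsilon> has_derivative blinfun_apply (F' \<epsilon> u)) (at u within S)" for u
      using F_deriv[OF \<epsilon>(1)] by (rule has_derivative_at_withinI)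
    have close: "norm (F' \<epsilon> u - F' \<epsilon> u0) \<le> \<rho> / 2" if "u \<in> S" for u
      using norm_blinfun_le_SUP_unit_ball[of "F' \<epsilon> u - F' \<epsilon> u0"] \<kappa>_le[of \<epsilon> "u - u0"] \<epsilon> that
      by (simp add: S_def \<delta>_def)
    have ball: "cball ?b ?r \<subseteq> S"
    proof
      fix u
      assume "u \<in> cball ?b ?r"
      then have "norm (u - ?b) \<le> ?r"
        by (metis mem_cball dist_norm dist_commute)
      then show "u \<in> S"
        using near[of u] fits by (simp add: S_def)
    qed
    note newton = simplified_newton[OF a_pos(2) below surj S deriv close ball]
    have "\<exists>!u. F \<epsilon> u = 0 \<and> N (u - u0) \<le> \<delta>"
      using newton(1) by (simp add: S_def conj_commute)
    moreover have "N (u - u0) \<le> N (?b - u0) + 4 * \<sigma> / \<rho> * norm (F \<epsilon> ?b)"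
      if "F \<epsilon> u = 0" "N (u - u0) \<le> \<delta>" for u
    proof -
      have "N (u - u0) \<le> N (?b - u0) + 2 * \<sigma> / \<rho> * norm (F \<epsilon> ?b)"
        using near newton(2)[of u] that by (simp add: S_def)
      also have "\<dots> \<le> N (?b - u0) + 4 * \<sigma> / \<rho> * norm (F \<epsilon> ?b)"
        using \<sigma>0 a_pos by (intro add_left_mono mult_right_mono divide_right_mono) auto
      finally show ?thesis .
    qed
    ultimately show ?thesis
      by blast
  qed
  then show ?thesis
    using \<epsilon>1 \<delta> by blast
qed

end
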